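(* Hierarchical models generated by Ferrer ideals are decomposable. That is: let $m,q\ge 1$, let $q\ge\lambda_1\ge\lambda_2\ge\dots\ge\lambda_m\ge 0$ be integers, and let $\mathcal{S}$ be the simplicial complex on $\mathcal{N}=\{1,\dots,m+q\}$ whose Stanley-Reisner ideal is the Ferrer ideal $$I_{\mathcal{S}}=\langle x_ix_{m+j}: 1\le i\le m,\ 1\le j\le\lambda_i\rangle\subseteq k[x_1,\dots,x_{m+q}].$$ Then the hierarchical model based on $\mathcal{S}$ is decomposable.
   Context: $k$ is a field. A simplicial complex $\mathcal{S}$ on $\mathcal{N}$ is a collection of subsets of $\mathcal{N}$ closed under taking subsets. Its Stanley-Reisner ideal $I_{\mathcal{S}}$ is the ideal generated by the square-free monomials $\prod_{i\in K}x_i$ for all $K\subseteq\mathcal{N}$ with $K\notin\mathcal{S}$. The hierarchical model based on $\mathcal{S}$ is the family of strictly positive densities of the form $f_X(x)=\exp\{\sum_{J\in\mathcal{S}}h_J(x_J)\}$, with $h_J:\mathbb{R}^J\to\mathbb{R}$ and $x_J$ the projection of $x$ to the coordinates in $J$. A Ferrer ideal is an ideal generated by degree-two square-free monomials, each the product of a "row" variable and a "column" variable, such that the generators placed in the row/column table form an inverse staircase (as in the displayed form with nonincreasing row lengths $\lambda_i$; some rows or columns may be empty). A finite graph $\mathcal{G}$ with vertex set $V$ is decomposable if either it is complete, or $V=I\cup J$ for proper subsets $I,J\subsetneq V$ such that $I\cap J$ is complete (possibly empty), there is no edge between $I\setminus J$ and $J\setminus I$, and the induced subgraphs on $I$ and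 on $J$ are both decomposable. The hierarchical model based on $\mathcal{S}$ is decomposable if $\mathcal{S}$ is the collection of all cliques (complete vertex subsets, including the empty set) of a decomposable graph on $\mathcal{N}$. *)

theory Defs
  imports "HOL-Algebra.Ideal" "HOL-Library.Poly_Mapping" "HOL-Library.Ramsey"
begin

text \<open>
  The polynomial ring \<open>k[x\<^sub>v | v \<in> V]\<close>.  A monomial is a finitely supported exponent map and a
  polynomial a finitely supported map from monomials to coefficients; the type provides a variable
  for every element of \<open>'v\<close>, and the carrier admits only those in \<open>V\<close>.
\<close>

type_synonym ('v, 'k) mvpoly = "('v \<Rightarrow>\<^sub>0 nat) \<Rightarrow>\<^sub>0 'k"

definition polynomial_ring :: "'v set \<Rightarrow> ('v, 'k::field) mvpoly ring" where
  "polynomial_ring V =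
    \<lparr>carrier = {p. \<forall>t \<in> Poly_Mapping.keys p. Poly_Mapping.keys t \<subseteq> V},
     monoid.mult = (*), one = 1, ring.zero = 0, add = (+)\<rparr>"

definition var :: "'v \<Rightarrow> ('v, 'k::field) mvpoly" where
  "var v = Poly_Mapping.single (Poly_Mapping.single v 1) 1"

lemma polynomial_ring_cring: "cring (polynomial_ring V :: ('v, 'k::field) mvpoly ring)"
proof -
  have keys_mult: "Poly_Mapping.keys t \<subseteq> V"
    if p: "\<forall>t \<in> Poly_Mapping.keys p. Poly_Mapping.keys t \<subseteq> V"
    and q: "\<forall>t \<in> Poly_Mapping.keys q. Poly_Mapping.keys t \<subseteq> V"
    and t: "t \<in> Poly_Mapping.keys (p * q)" for p q :: "('v, 'k) mvpoly" and t
  proof -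
    from t keys_mult[of p q] obtain a b
      where "t = a + b" "a \<in> Poly_Mapping.keys p" "b \<in> Poly_Mapping.keys q" by blast
    with p q Poly_Mapping.keys_add[of a b] show ?thesis by blast
  qed
  have keys_plus: "Poly_Mapping.keys t \<subseteq> V"
    if p: "\<forall>t \<in> Poly_Mapping.keys p. Poly_Mapping.keys t \<subseteq> V"
    and q: "\<forall>t \<in> Poly_Mapping.keys q. Poly_Mapping.keys t \<subseteq> V"
    and t: "t \<in> Poly_Mapping.keys (p + q)" for p q :: "('v, 'k) mvpoly" and t
    using p q t Poly_Mapping.keys_add[of p q] by blast
  show ?thesis
  proof (rule cringI)
    show "abelian_group (polynomial_ring V :: ('v, 'k) mvpoly ring)"
    proof (rule abelian_groupI)
      fix x :: "('v, 'k) mvpoly"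
      assume "x \<in> carrier (polynomial_ring V)"
      then show "\<exists>y \<in> carrier (polynomial_ring V).
          y \<oplus>\<^bsub>polynomial_ring V\<^esub> x = \<zero>\<^bsub>polynomial_ring V\<^esub>"
        by (intro bexI[of _ "- x"]) (auto simp: polynomial_ring_def)
    qed (simp_all add: polynomial_ring_def add.assoc add.commute, use keys_plus in blast)
    show "Group.comm_monoid (polynomial_ring V :: ('v, 'k) mvpoly ring)"
      by (rule comm_monoidI) (simp_all add: polynomial_ring_def mult.assoc mult.commute, use keys_mult in blast)
  qed (simp add: polynomial_ring_def distrib_right)
qed

lemma var_in_carrier: "v \<in> V \<Longrightarrow> var v \<in> carrier (polynomial_ring V)"
  by (simp add: var_def polynomial_ring_def)

definition simplicial_complex :: "'v set \<Rightarrow> 'v set set \<Rightarrow> bool" where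
  "simplicial_complex N S \<longleftrightarrow> S \<subseteq> Pow N \<and> (\<forall>J \<in> S. \<forall>K. K \<subseteq> J \<longrightarrow> K \<in> S)"

definition stanley_reisner_ideal :: "'v set \<Rightarrow> 'v set set \<Rightarrow> ('v, 'k::field) mvpoly set" where
  "stanley_reisner_ideal N S =
    Idl\<^bsub>polynomial_ring N\<^esub> {\<Prod>i\<in>K. var i | K. K \<subseteq> N \<and> K \<notin> S}"

text \<open>
  The row variables are \<open>x\<^sub>1, \<dots>, x\<^sub>m\<close> and the column variables \<open>x\<^bsub>m+1\<^esub>, \<dots>, x\<^bsub>m+q\<^esub>\<close>; row \<open>i\<close> of the
  table holds the generators in its first \<open>\<lambda>\<^sub>i\<close> columns.  The staircase condition on the row lengths
  is not part of the definition.
\<close>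

definition ferrer_ideal :: "nat \<Rightarrow> nat \<Rightarrow> (nat \<Rightarrow> nat) \<Rightarrow> (nat, 'k::field) mvpoly set" where
  "ferrer_ideal m q lam =
    Idl\<^bsub>polynomial_ring {1..m + q}\<^esub>
      {var i * var (m + j) | i j. 1 \<le> i \<and> i \<le> m \<and> 1 \<le> j \<and> j \<le> lam i}"

definition finite_graph :: "'v set \<Rightarrow> 'v set set \<Rightarrow> bool" where
  "finite_graph V E \<longleftrightarrow> finite V \<and> E \<subseteq> nsets V 2"

definition induced_edges :: "'v set set \<Rightarrow> 'v set \<Rightarrow> 'v set set" where
  "induced_edges E I = {e \<in> E. e \<subseteq> I}"

inductive decomposable_graph :: "'v set \<Rightarrow> 'v set set \<Rightarrow> bool" where
  complete: "finite_graph V E \<Longrightarrow> clique V E \<Longrightarrow> decomposable_graph V E"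
| decompose: "finite_graph V E \<Longrightarrow> V = I \<union> J \<Longrightarrow> I \<subset> V \<Longrightarrow> J \<subset> V \<Longrightarrow> clique (I \<inter> J) E \<Longrightarrow>
    (\<forall>a \<in> I - J. \<forall>b \<in> J - I. {a, b} \<notin> E) \<Longrightarrow>
    decomposable_graph I (induced_edges E I) \<Longrightarrow> decomposable_graph J (induced_edges E J) \<Longrightarrow>
    decomposable_graph V E"

definition clique_complex :: "'v set \<Rightarrow> 'v set set \<Rightarrow> 'v set set" where
  "clique_complex V E = {C. C \<subseteq> V \<and> clique C E}"

text \<open>
  The hierarchical model based on \<open>S\<close> consists of the strictly positive densities
  \<open>exp (\<Sum>J\<in>S. h\<^sub>J x\<^sub>J)\<close>.  Its decomposability is by definition a condition on the generating
  complex \<open>S\<close> alone, so the predicate takes \<open>S\<close>.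
\<close>

definition decomposable_hierarchical_model :: "'v set \<Rightarrow> 'v set set \<Rightarrow> bool" where
  "decomposable_hierarchical_model N S \<longleftrightarrow>
    (\<exists>E. decomposable_graph N E \<and> S = clique_complex N E)"

end

theory Submission
  imports Defs
begin

text \<open>
  A square-free monomial lies in a monomial ideal only if some generator divides it, so \<open>S\<close> is the
  clique complex of the graph whose non-edges are the generators of the Ferrer ideal.  In that graph
  rows and columns form two cliques.  Take a row \<open>r\<close> of maximal length: the columns beyond its end
  are adjacent to everything, so all rows together with these columns form a clique that separates
  \<open>r\<close> from the remaining columns.  Splitting off \<open>r\<close> leaves a table with one row fewer.
\<close>

section \<open>Decomposability of graphs complementary to staircase tables\<close>

text \<open>Here \<open>f\<close> plays the part of the row length and \<open>g\<close> that of the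
  column position. The non-neighbours of a row among the columns are nested because \<open>f\<close>
  and \<open>g\<close> take values in a linear order. Arbitrary finite sets of rows thus stay in the
  class, which suits an induction on rows.\<close>

definition ferrer_graph :: "'v set \<Rightarrow> 'v set \<Rightarrow> ('v \<Rightarrow> 'a::linorder) \<Rightarrow> ('v \<Rightarrow> 'a) \<Rightarrow> 'v set set" where
  "ferrer_graph R C f g = nsets (R \<union> C) 2 - {{r, c} | r c. r \<in> R \<and> c \<in> C \<and> g c \<le> f r}"

lemma doubleton_in_ferrer_graph_iff:
  assumes "R \<inter> C = {}"
  shows "{a, b} \<in> ferrer_graph R C f g \<longleftrightarrow>
    a \<noteq> b \<and> a \<in> R \<union> C \<and> b \<in> R \<union> C \<and>
    \<not> (a \<in> R \<and> b \<in> C \<and> g b \<le> f a) \<and> \<not> (b \<in> R \<and> a \<in> C \<and> g a \<le> f b)"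
  using assms by (auto simp: ferrer_graph_def nsets_def doubleton_eq_iff card_2_iff)

lemma finite_graph_ferrer_graph:
  "finite R \<Longrightarrow> finite C \<Longrightarrow> finite_graph (R \<union> C) (ferrer_graph R C f g)"
  by (auto simp: finite_graph_def ferrer_graph_def)

lemma finite_graph_induced_edges:
  assumes "finite_graph V E" "I \<subseteq> V"
  shows "finite_graph I (induced_edges E I)"
  using assms finite_subset by (auto simp: finite_graph_def induced_edges_def nsets_def)

text \<open>The class is closed under induced subgraphs, which lets the induction hypothesis speak
  about the piece left after a row is split off. Disjointness forces a non-edge inside
  \<open>R' \<union> C'\<close> to have its row in \<open>R'\<close> and its column in
  \<open>C'\<close>.\<close>

lemma induced_edges_ferrer_graph:
  assumes "R' \<subseteq> R" "C' \<subseteq> C" "R \<inter> C = {}"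
  shows "induced_edges (ferrer_graph R C f g) (R' \<union> C') = ferrer_graph R' C' f g"
proof -
  let ?B = "\<lambda>R C. {{r, c} | r c. r \<in> R \<and> c \<in> C \<and> g c \<le> f r}"
  have "r \<in> R' \<and> c \<in> C'" if "r \<in> R" "c \<in> C" "{r, c} \<subseteq> R' \<union> C'" for r c
    using that assms by blast
  then have "e \<in> ?B R' C'" if "e \<in> ?B R C" "e \<subseteq> R' \<union> C'" for e
    using that by blast
  moreover have "?B R' C' \<subseteq> ?B R C"
    using assms(1,2) by blast
  moreover have "nsets (R' \<union> C') 2 = {e \<in> nsets (R \<union> C) 2. e \<subseteq> R' \<union> C'}"
    using assms(1,2) by (auto simp: nsets_def)
  moreover have "{e \<in> A - B. e \<subseteq> X} = A' - B'"
    if "\<And>e. e \<in> B \<Longrightarrow> e \<subseteq> X \<Longrightarrow> e \<in> B'" "B' \<subseteq> B" "A' = {e \<in> A. e \<subseteq> X}"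
    for A A' B B' :: "'a set set" and X
    using that by blast
  ultimately show ?thesis
    unfolding induced_edges_def ferrer_graph_def by presburger
qed

lemma decomposable_ferrer_graph:
  fixes f g :: "'v \<Rightarrow> 'a::linorder"
  assumes "finite R" "finite C" "R \<inter> C = {}"
  shows "decomposable_graph (R \<union> C) (ferrer_graph R C f g)"
  using assms(1,3)
\<comment> \<open>Rows are inserted by nondecreasing \<open>f\<close>, so the new row
  \<open>r\<close> satisfies \<open>f y \<le> f r\<close> for every earlier row
  \<open>y\<close>.\<close>
proof (induction R rule: finite_ranking_induct[where f = f])
  case empty
  show ?case
    using finite_graph_ferrer_graph[of "{}" C f g] assms(2)
    by (intro decomposable_graph.complete)
      (auto simp: clique_def doubleton_in_ferrer_graph_iff)
next
  case (insert r R)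
  have disj: "insert r R \<inter> C = {}"
    using insert.prems by blast
  let ?E = "ferrer_graph (insert r R) C f g"
  have fin: "finite_graph (insert r R \<union> C) ?E"
    using insert.hyps assms(2) by (intro finite_graph_ferrer_graph) auto
  \<comment> \<open>The columns beyond the end of row \<open>r\<close>. By maximality of
    \<open>f r\<close> no other row reaches them either, so they are adjacent to all rows.\<close>
  define D where "D = {c \<in> C. f r < g c}"
  have clq: "clique (insert r R \<union> D) ?E"
    using disj insert.hyps(2)
    by (fastforce simp: clique_def doubleton_in_ferrer_graph_iff[OF disj] D_def)
  \<comment> \<open>The first two cases are those where a piece fails to be proper: the induction
    rule does not provide \<open>r \<notin> R\<close>, and \<open>D = C\<close> makes the whole
    graph complete.\<close>
  consider "r \<in> R" | "D = C" | "r \<notin> R" "D \<subset> C"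
    unfolding D_def by blast
  then show ?case
  proof cases
    case 1
    then show ?thesis
      using insert.IH insert.prems by (simp add: insert_absorb)
  next
    case 2
    with clq fin show ?thesis
      by (auto intro: decomposable_graph.complete)
  next
    case 3
    \<comment> \<open>\<open>?I\<close> is the clique found above and \<open>?J\<close> drops
      \<open>r\<close>. They meet in \<open>R \<union> D\<close>; \<open>?I - ?J\<close> is just
      \<open>r\<close>, and \<open>?J - ?I\<close> consists of the columns that row \<open>r\<close>
      reaches, none of them adjacent to \<open>r\<close>.\<close>
    let ?I = "insert r R \<union> D" and ?J = "R \<union> C"
    show ?thesis
    proof (rule decomposable_graph.decompose[OF fin, where I = ?I and J = ?J])
      show "insert r R \<union> C = ?I \<union> ?J" "?I \<subset> insert r R \<union> C" "?J \<subset> insert r R \<union> C"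
        using 3 disj by blast+
      show "clique (?I \<inter> ?J) ?E"
        using clq by (auto simp: clique_def)
      show "\<forall>a\<in>?I - ?J. \<forall>b\<in>?J - ?I. {a, b} \<notin> ?E"
        by (auto simp: doubleton_in_ferrer_graph_iff[OF disj] D_def)
      show "decomposable_graph ?I (induced_edges ?E ?I)"
      proof (rule decomposable_graph.complete)
        show "finite_graph ?I (induced_edges ?E ?I)"
          using fin by (rule finite_graph_induced_edges) (auto simp: D_def)
        show "clique ?I (induced_edges ?E ?I)"
          using clq by (simp add: clique_def induced_edges_def)
      qed
      show "decomposable_graph ?J (induced_edges ?E ?J)"
        using insert.IH disj by (subst induced_edges_ferrer_graph) auto
    qed
  qed
qed

section \<open>Square-free monomials in monomial ideals\<close>

lemma prod_var_eq_single:
  "(\<Prod>i\<in>K. var i :: ('v, 'k::field) mvpoly) =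
    Poly_Mapping.single (\<Sum>i\<in>K. Poly_Mapping.single i 1) 1"
  by (induction K rule: infinite_finite_induct) (auto simp: var_def mult_single)

text \<open>Natural exponents cannot cancel, so the general inclusion becomes an equality.\<close>

lemma keys_plus_nat:
  fixes a b :: "'v \<Rightarrow>\<^sub>0 nat"
  shows "Poly_Mapping.keys (a + b) = Poly_Mapping.keys a \<union> Poly_Mapping.keys b"
  by (auto simp: in_keys_iff lookup_add)

lemma keys_sum_single_one:
  "finite K \<Longrightarrow> Poly_Mapping.keys (\<Sum>i\<in>K. Poly_Mapping.single i (1::nat)) = K"
  by (induction K rule: finite_induct) (auto simp: keys_plus_nat)

text \<open>Sums create no new monomials and products only enlarge supports. For the square-free
  generators with supports in \<open>D\<close>, this ideal bounds the generated one from
  above.\<close>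

lemma ideal_keys_contain_member:
  "ideal {p :: ('v, 'k::field) mvpoly. \<forall>t \<in> Poly_Mapping.keys p.
     Poly_Mapping.keys t \<subseteq> V \<and> (\<exists>K \<in> D. K \<subseteq> Poly_Mapping.keys t)} (polynomial_ring V)"
    (is "ideal ?M ?R")
proof -
  interpret cring ?R
    by (rule polynomial_ring_cring)
  have uminus: "\<ominus>\<^bsub>?R\<^esub> p = - p" if "p \<in> carrier ?R" for p
    using that by (intro minus_equality) (auto simp: polynomial_ring_def)
  have mult: "p * r \<in> ?M" if "p \<in> ?M" "r \<in> carrier ?R" for p r
  proof -
    have "Poly_Mapping.keys t \<subseteq> V \<and> (\<exists>K \<in> D. K \<subseteq> Poly_Mapping.keys t)"
      if "t \<in> Poly_Mapping.keys (p * r)" for t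
    proof -
      from that keys_mult[of p r] obtain a b
        where t: "t = a + b" and a: "a \<in> Poly_Mapping.keys p" and b: "b \<in> Poly_Mapping.keys r"
        by blast
      from \<open>p \<in> ?M\<close> a have "Poly_Mapping.keys a \<subseteq> V" "\<exists>K \<in> D. K \<subseteq> Poly_Mapping.keys a"
        by auto
      moreover from \<open>r \<in> carrier ?R\<close> b have "Poly_Mapping.keys b \<subseteq> V"
        by (simp add: polynomial_ring_def)
      ultimately show ?thesis
        unfolding t keys_plus_nat by blast
    qed
    then show ?thesis by blast
  qed
  have sub: "?M \<subseteq> carrier ?R"
    by (auto simp: polynomial_ring_def)
  show ?thesis
  proof (rule idealI[OF ring_axioms])
    show "subgroup ?M (add_monoid ?R)"
    proof (rule add.subgroupI)
      show "?M \<subseteq> carrier ?R" by (rule sub)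
      show "?M \<noteq> {}" by (auto intro: exI[of _ 0])
      show "\<ominus>\<^bsub>?R\<^esub> p \<in> ?M" if "p \<in> ?M" for p
        using that sub by (subst uminus) auto
      show "p \<oplus>\<^bsub>?R\<^esub> r \<in> ?M" if "p \<in> ?M" "r \<in> ?M" for p r
        using that Poly_Mapping.keys_add[of p r] by (auto simp: polynomial_ring_def)
    qed
    show "x \<otimes>\<^bsub>?R\<^esub> a \<in> ?M" if "a \<in> ?M" "x \<in> carrier ?R" for a x
      using mult[OF that] by (simp add: polynomial_ring_def mult.commute)
    show "a \<otimes>\<^bsub>?R\<^esub> x \<in> ?M" if "a \<in> ?M" "x \<in> carrier ?R" for a x
      using mult[OF that] by (simp add: polynomial_ring_def)
  qed
qed

text \<open>Forwards, minimality puts the generated ideal inside the ideal \<open>?M\<close> of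
  polynomials whose monomials are all divisible by a generator, and the product over
  \<open>K\<close> has a single monomial, with support \<open>K\<close>. Backwards, the generator
  for \<open>L\<close> is multiplied by the cofactor over \<open>K - L\<close>.\<close>

lemma squarefree_monomial_in_ideal_iff:
  assumes "finite V" "K \<subseteq> V" "D \<subseteq> Pow V"
  shows "(\<Prod>i\<in>K. var i :: ('v, 'k::field) mvpoly) \<in>
      Idl\<^bsub>polynomial_ring V\<^esub> ((\<lambda>L. \<Prod>i\<in>L. var i) ` D) \<longleftrightarrow> (\<exists>L \<in> D. L \<subseteq> K)"
    (is "?x K \<in> Idl\<^bsub>?R\<^esub> ?G \<longleftrightarrow> _")
proof
  interpret cring ?R
    by (rule polynomial_ring_cring)
  have keys: "Poly_Mapping.keys (?x L) = {\<Sum>i\<in>L. Poly_Mapping.single i 1}" for L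
    by (simp add: prod_var_eq_single)
  have keys': "Poly_Mapping.keys (\<Sum>i\<in>L. Poly_Mapping.single i (1::nat)) = L" if "L \<subseteq> V" for L
    using that assms(1) finite_subset keys_sum_single_one by blast
  have carrier: "?x L \<in> carrier ?R" if "L \<subseteq> V" for L
    using that keys'[OF that] by (simp add: polynomial_ring_def keys)
  have G: "?G \<subseteq> carrier ?R"
    using carrier assms(3) by blast
  {
    let ?M = "{p :: ('v, 'k) mvpoly. \<forall>t \<in> Poly_Mapping.keys p.
       Poly_Mapping.keys t \<subseteq> V \<and> (\<exists>L \<in> D. L \<subseteq> Poly_Mapping.keys t)}"
    assume "?x K \<in> Idl\<^bsub>?R\<^esub> ?G"
    moreover have "?G \<subseteq> ?M"
    proof clarify
      fix L t assume "L \<in> D" "t \<in> Poly_Mapping.keys (?x L)"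
      then show "Poly_Mapping.keys t \<subseteq> V \<and> (\<exists>L \<in> D. L \<subseteq> Poly_Mapping.keys t)"
        using assms(3) keys'[of L] unfolding keys by (metis PowD empty_iff insert_iff order_refl subsetD)
    qed
    then have "Idl\<^bsub>?R\<^esub> ?G \<subseteq> ?M"
      by (intro genideal_minimal ideal_keys_contain_member)
    ultimately have "?x K \<in> ?M" by blast
    then show "\<exists>L \<in> D. L \<subseteq> K"
      using keys'[OF assms(2)] by (simp add: keys)
  next
    assume "\<exists>L \<in> D. L \<subseteq> K"
    then obtain L where L: "L \<in> D" "L \<subseteq> K" by blast
    interpret ideal "Idl\<^bsub>?R\<^esub> ?G" ?R
      using G by (rule genideal_ideal)
    have "?x L \<in> Idl\<^bsub>?R\<^esub> ?G"
      using L genideal_self[OF G] by blast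
    moreover have "?x (K - L) \<in> carrier ?R"
      using assms(2) by (intro carrier) blast
    ultimately have "?x (K - L) \<otimes>\<^bsub>?R\<^esub> ?x L \<in> Idl\<^bsub>?R\<^esub> ?G"
      by (rule I_l_closed)
    moreover have "?x K = ?x (K - L) * ?x L"
      using L assms(1,2) finite_subset by (intro prod.subset_diff) auto
    ultimately show "?x K \<in> Idl\<^bsub>?R\<^esub> ?G"
      by (simp add: polynomial_ring_def)
  }
qed

section \<open>From the equality of ideals to the clique complex\<close>

theorem theorem7:
  fixes m q :: nat and lam :: "nat \<Rightarrow> nat" and S :: "nat set set"
  assumes "m \<ge> 1" and "q \<ge> 1"
    and "lam 1 \<le> q"
    and "\<And>i. 1 \<le> i \<Longrightarrow> i < m \<Longrightarrow> lam (i + 1) \<le> lam i"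
    and "simplicial_complex {1..m + q} S"
    and "(stanley_reisner_ideal {1..m + q} S :: (nat, 'k::field) mvpoly set) = ferrer_ideal m q lam"
  shows "decomposable_hierarchical_model {1..m + q} S"
proof -
  let ?N = "{1..m + q}"
  let ?x = "\<lambda>L. \<Prod>i\<in>L. var i :: (nat, 'k) mvpoly"
  \<comment> \<open>Keeps every generator inside the table, so that each \<open>m + j\<close> is a
    vertex of \<open>?N\<close>.\<close>
  have lam_le: "lam i \<le> q" if "1 \<le> i" "i \<le> m" for i
    using that
  proof (induction i rule: dec_induct)
    case base
    show ?case by (rule assms(3))
  next
    case (step n)
    then show ?case using assms(4)[of n] by simp
  qed
  \<comment> \<open>\<open>D\<close> collects the non-faces and \<open>F\<close> the supports of the
    Ferrer generators; they index two generating sets of the same ideal.\<close>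
  define D where "D = {K. K \<subseteq> ?N \<and> K \<notin> S}"
  define F where "F = {{i, m + j} | i j. 1 \<le> i \<and> i \<le> m \<and> 1 \<le> j \<and> j \<le> lam i}"
  have F_sub: "F \<subseteq> Pow ?N"
    using lam_le unfolding F_def by fastforce
  \<comment> \<open>The bounds give \<open>i \<noteq> m + j\<close>, so the product over the set has
    two factors.\<close>
  have pair: "?x {i, m + j} = var i * var (m + j)" if "i \<le> m" "1 \<le> j" for i j
    using that by simp
  have "{var i * var (m + j) | i j. 1 \<le> i \<and> i \<le> m \<and> 1 \<le> j \<and> j \<le> lam i} = ?x ` F"
    (is "?G = _")
  proof (intro equalityI subsetI)
    fix p assume "p \<in> ?G"
    then obtain i j where ij: "1 \<le> i" "i \<le> m" "1 \<le> j" "j \<le> lam i" "p = var i * var (m + j)"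
      by blast
    then have "{i, m + j} \<in> F" "p = ?x {i, m + j}"
      using pair[of i j] unfolding F_def by auto
    then show "p \<in> ?x ` F" by blast
  next
    fix p assume "p \<in> ?x ` F"
    then obtain i j where "1 \<le> i" "i \<le> m" "1 \<le> j" "j \<le> lam i" "p = ?x {i, m + j}"
      unfolding F_def by blast
    then show "p \<in> ?G"
      using pair[of i j] by blast
  qed
  then have "ferrer_ideal m q lam = Idl\<^bsub>polynomial_ring ?N\<^esub> (?x ` F)"
    by (simp add: ferrer_ideal_def)
  moreover have "stanley_reisner_ideal ?N S = Idl\<^bsub>polynomial_ring ?N\<^esub> (?x ` D)"
    by (simp add: stanley_reisner_ideal_def D_def image_Collect Setcompr_eq_image)
  \<comment> \<open>Both sides express that the monomial with support \<open>K\<close> lies in the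
    common ideal.\<close>
  ultimately have D_iff_F: "(\<exists>L \<in> D. L \<subseteq> K) \<longleftrightarrow> (\<exists>L \<in> F. L \<subseteq> K)" if "K \<subseteq> ?N" for K
    using squarefree_monomial_in_ideal_iff[OF _ that, where 'k = 'k] F_sub assms(6)
    by (metis (no_types, lifting) D_def PowI finite_atLeastAtMost mem_Collect_eq subsetI)
  \<comment> \<open>Non-faces are closed under supersets, as \<open>S\<close> is closed under
    subsets.\<close>
  have D_iff_S: "(\<exists>L \<in> D. L \<subseteq> K) \<longleftrightarrow> K \<notin> S" if "K \<subseteq> ?N" for K
    using that assms(5) unfolding simplicial_complex_def D_def by blast
  have mem_S: "K \<in> S \<longleftrightarrow> (\<forall>L \<in> F. \<not> L \<subseteq> K)" if "K \<subseteq> ?N" for K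
    using D_iff_F[OF that] D_iff_S[OF that] by blast
  let ?R = "{1..m}" and ?C = "{m + 1..m + q}"
  \<comment> \<open>\<open>c - m\<close> is the column number, counted from 1; the subtraction is
    exact since \<open>c > m\<close> on \<open>?C\<close>.\<close>
  let ?E = "ferrer_graph ?R ?C lam (\<lambda>c. c - m)"
  have N: "?N = ?R \<union> ?C" and disj: "?R \<inter> ?C = {}"
    by auto
  have F_eq: "F = {{r, c} | r c. r \<in> ?R \<and> c \<in> ?C \<and> c - m \<le> lam r}"
  proof -
    have "\<exists>j. c = m + j \<and> 1 \<le> j \<and> j \<le> lam r" if "c \<in> ?C" "c - m \<le> lam r" for c r
      using that by (intro exI[of _ "c - m"]) auto
    moreover have "m + j \<in> ?C \<and> m + j - m \<le> lam i" if "1 \<le> i" "i \<le> m" "1 \<le> j" "j \<le> lam i" for i j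
      using that lam_le[of i] by simp
    ultimately show ?thesis
      unfolding F_def atLeastAtMost_iff by blast
  qed
  have E_eq: "?E = nsets ?N 2 - F"
    unfolding ferrer_graph_def F_eq N ..
  \<comment> \<open>The non-edges on \<open>?N\<close> are exactly the members of \<open>F\<close>,
    so cliques obey the same criterion as faces in \<open>mem_S\<close>.\<close>
  have clique_iff: "clique K ?E \<longleftrightarrow> (\<forall>L \<in> F. \<not> L \<subseteq> K)" if "K \<subseteq> ?N" for K
  proof
    assume "clique K ?E"
    show "\<forall>L \<in> F. \<not> L \<subseteq> K"
    proof (intro ballI notI)
      fix L assume "L \<in> F" "L \<subseteq> K"
      then obtain r c where "L = {r, c}" "r \<in> K" "c \<in> K" "r \<noteq> c"
        unfolding F_eq using disj by fastforce
      with \<open>clique K ?E\<close> have "L \<in> ?E"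
        by (simp add: clique_def)
      with \<open>L \<in> F\<close> show False
        unfolding E_eq by simp
    qed
  next
    assume *: "\<forall>L \<in> F. \<not> L \<subseteq> K"
    show "clique K ?E"
      unfolding clique_def
    proof (intro ballI impI)
      fix v w assume vw: "v \<in> K" "w \<in> K" "v \<noteq> w"
      then have "{v, w} \<subseteq> K"
        by simp
      then have "{v, w} \<notin> F"
        using * by auto
      moreover have "{v, w} \<in> nsets ?N 2"
        using vw subset_trans[OF \<open>{v, w} \<subseteq> K\<close> that] by (simp add: nsets_def)
      ultimately show "{v, w} \<in> ?E"
        unfolding E_eq by (rule DiffI[rotated])
    qed
  qed
  have "S = clique_complex ?N ?E"
  proof (rule Set.set_eqI)
    fix K
    show "K \<in> S \<longleftrightarrow> K \<in> clique_complex ?N ?E"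
    proof (cases "K \<subseteq> ?N")
      case True
      then show ?thesis
        using mem_S[OF True] clique_iff[OF True] unfolding clique_complex_def mem_Collect_eq by argo
    next
      case False
      then show ?thesis
        using assms(5) unfolding simplicial_complex_def clique_complex_def by blast
    qed
  qed
  moreover have "decomposable_graph ?N ?E"
    unfolding N using disj by (intro decomposable_ferrer_graph) simp_all
  ultimately show ?thesis
    unfolding decomposable_hierarchical_model_def by (intro exI[of _ ?E] conjI)
qed

end
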